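(* Consider the genus one setting in the context, with the moments $s_j$ defined by $s_0=u_1/2$, $s_1=-s_0v_1$ and, for $j\ge2$, $$s_j=-(2d_1+f)s_{j-2}+s_0^{-1}d_1\Big(\sum_{i=0}^{j-2}s_is_{j-2-i}-v_0\sum_{i=0}^{j-3}s_is_{j-3-i}\Big),$$ and $\Delta_n=\det(s_{i+j-2})_{i,j=1}^n$ ($\Delta_0=1$). Then for all $n\ge0$, $$\Delta_{n+4}\Delta_n=\alpha\,\Delta_{n+3}\Delta_{n+1}+\beta\,\Delta_{n+2}^2,\qquad \alpha=u^2,\ \beta=u^2(v^2+f).$$ Moreover, every solution $(\tau_n)_{n\in\mathbb{Z}}$ of a Somos-4 recurrence $\tau_{n+4}\tau_n=\alpha\tau_{n+3}\tau_{n+1}+\beta\tau_{n+2}^2$ (with $\alpha\neq0$ and all $\tau_n\neq0$) can be written, for a suitable choice of the genus one data with $\alpha=u^2$, $\beta=u^2(v^2+f)$, and suitable constants $\hat a,\hat b,a^\dagger,b^\dagger$, as $\tau_n=\hat a\hat b^n\Delta_n$ for $n\ge0$ and $\tau_n=a^\dagger(b^\dagger)^n\Delta^\dagger_{-n-1}$ for $n\le-1$, where $\Delta^\dagger_m=\det(s^\dagger_{i+j-2})_{i,j=1}^m$ with $s^\dagger_0=-u_{-1}/2$, $s^\dagger_1=-s^\dagger_0v_{-1}$ and, for $j\ge2$, $s^\dagger_j=-(2d_0+f)s^\dagger_{j-2}+(s^\dagger_0)^{-1}d_0\big(\sum_{i=0}^{j-2}s^\dagger_is^\dagger_{j-2-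i}-v_0\sum_{i=0}^{j-3}s^\dagger_is^\dagger_{j-3-i}\big)$.
   Context: Genus one setting: curve $Y^2=(X^2+f)^2+4u(X-v)$ with $f,u,v\in\mathbb{C}$, $u\ne0$; points at infinity $\infty_1$ ($Y\sim X^2$) and $\infty_2$ ($Y\sim-X^2$). Take $P_0=X^2+f+2d_0$ and $Q_0=u_0(X-v_0)$, $u_0\neq0$, with $Q_0\mid F-P_0^2$, and $Y_0=(Y+P_0)/Q_0$ expanded at $\infty_1$ in powers of $X^{-1}$. The continued fraction $Y_n=a_n+1/Y_{n+1}$, $a_n=\lfloor Y_n\rfloor$, gives $a_n=2(X+v_n)/u_n$, $Y_n=(Y+P_n)/Q_n$ with $P_n=X^2+f+2d_n$, $Q_n=u_n(X-v_n)$, satisfying $F=P_n^2+Q_nQ_{n-1}$ and $4d_n+u_nu_{n-1}=0$; equivalently $(d_{n+1},v_{n+1})=(-d_n-v_n^2-f,\,-v_n-u/(d_n+v_n^2+f))$. These relations are extended to all $n\in\mathbb{Z}$ by iterating backwards (together with $(X+v_n)Q_n=\tfrac12u_n(P_{n+1}+P_n)$), assuming all $u_n,d_n$ nonzero. *)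

theory Defs
  imports
    "HOL-Computational_Algebra.Formal_Laurent_Series"
    "HOL-Computational_Algebra.Polynomial"
    "Jordan_Normal_Form.Determinant"
begin

text \<open>
  Expansions at infinity in powers of \<open>1/X\<close> are formal Laurent series in the local
  parameter \<open>1/X\<close>: the library's variable \<^const>\<open>fls_X\<close> stands for \<open>1/X\<close>, and
  \<^const>\<open>fls_X_inv\<close> for \<open>X\<close>.  So the coefficient of \<open>X^k\<close> in \<open>y\<close> is \<open>fls_nth y (-k)\<close>.
\<close>

definition at_inf :: "complex poly \<Rightarrow> complex fls" where
  "at_inf p = poly (map_poly fls_const p) fls_X_inv"

text \<open>The floor of a series is its polynomial part in \<open>X\<close>; \<^const>\<open>fls_prpart\<close> omits
  the constant term.\<close>

definition poly_floor :: "complex fls \<Rightarrow> complex poly" where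
  "poly_floor y = fls_prpart y + [:fls_nth y 0:]"

definition curve_poly :: "complex \<Rightarrow> complex \<Rightarrow> complex \<Rightarrow> complex poly" where
  "curve_poly f u v = [:f, 0, 1:]\<^sup>2 + Polynomial.smult (4 * u) [:- v, 1:]"

text \<open>The function \<open>Y\<close> expanded at the point at infinity where \<open>Y\<close> behaves like \<open>X^2\<close>
  (rather than \<open>-X^2\<close>); see \<open>curve_Y_ex1\<close> below.\<close>

definition curve_Y :: "complex \<Rightarrow> complex \<Rightarrow> complex \<Rightarrow> complex fls" where
  "curve_Y f u v = (THE y. y\<^sup>2 = at_inf (curve_poly f u v) \<and>
                           fls_subdegree y = -2 \<and> fls_nth y (-2) = 1)"

definition cf_P :: "complex \<Rightarrow> (int \<Rightarrow> complex) \<Rightarrow> int \<Rightarrow> complex poly" where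
  "cf_P f d n = [:f + 2 * d n, 0, 1:]"

definition cf_Q :: "(int \<Rightarrow> complex) \<Rightarrow> (int \<Rightarrow> complex) \<Rightarrow> int \<Rightarrow> complex poly" where
  "cf_Q us vs n = Polynomial.smult (us n) [:- vs n, 1:]"

definition cf_Y :: "complex \<Rightarrow> complex \<Rightarrow> complex \<Rightarrow> (int \<Rightarrow> complex) \<Rightarrow> (int \<Rightarrow> complex)
    \<Rightarrow> (int \<Rightarrow> complex) \<Rightarrow> int \<Rightarrow> complex fls" where
  "cf_Y f u v d us vs n =
     (curve_Y f u v + at_inf (cf_P f d n)) / at_inf (cf_Q us vs n)"

text \<open>
  The constants \<open>f, u, v\<close> fix the curve and \<open>d, us, vs\<close> are the two-sided sequences
  \<open>d_n, u_n, v_n\<close>; all of them are determined by \<open>f, u, v\<close> and \<open>d 0, us 0, vs 0\<close>.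
  The continued fraction expansion is imposed for \<open>n \<ge> 0\<close>.  The last two conditions are
  what extends the sequences to negative \<open>n\<close>; for \<open>n > 0\<close> resp. \<open>n \<ge> 0\<close> they
  already follow from the continued fraction.
\<close>

definition genus_one_data :: "complex \<Rightarrow> complex \<Rightarrow> complex \<Rightarrow> (int \<Rightarrow> complex)
    \<Rightarrow> (int \<Rightarrow> complex) \<Rightarrow> (int \<Rightarrow> complex) \<Rightarrow> bool" where
  "genus_one_data f u v d us vs \<longleftrightarrow>
     u \<noteq> 0 \<and> (\<forall>n. us n \<noteq> 0 \<and> d n \<noteq> 0) \<and>
     cf_Q us vs 0 dvd curve_poly f u v - (cf_P f d 0)\<^sup>2 \<and>
     (\<forall>n\<ge>0. cf_Y f u v d us vs n =
        at_inf (poly_floor (cf_Y f u v d us vs n)) + 1 / cf_Y f u v d us vs (n + 1)) \<and>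
     (\<forall>n. curve_poly f u v = (cf_P f d n)\<^sup>2 + cf_Q us vs n * cf_Q us vs (n - 1)) \<and>
     (\<forall>n. [:vs n, 1:] * cf_Q us vs n = Polynomial.smult (us n / 2) (cf_P f d (n + 1) + cf_P f d n))"

text \<open>
  The recursion for both families of moments, with first two values \<open>s0, s1\<close> and parameters
  \<open>\<delta>\<close> (\<open>d_1\<close> resp. \<open>d_0\<close>) and \<open>w\<close> (\<open>v_0\<close>).  The third equation defines the moment of
  index \<open>j + 2\<close>, so the upper summation limits are shifted by two.
\<close>

fun moment_rec :: "complex \<Rightarrow> complex \<Rightarrow> complex \<Rightarrow> complex \<Rightarrow> complex \<Rightarrow> nat \<Rightarrow> complex" where
  "moment_rec f \<delta> w s0 s1 0 = s0"
| "moment_rec f \<delta> w s0 s1 (Suc 0) = s1"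
| "moment_rec f \<delta> w s0 s1 (Suc (Suc j)) =
     - (2 * \<delta> + f) * moment_rec f \<delta> w s0 s1 j
     + inverse s0 * \<delta> *
       ((\<Sum>i\<le>j. moment_rec f \<delta> w s0 s1 i * moment_rec f \<delta> w s0 s1 (j - i))
        - w * (\<Sum>i<j. moment_rec f \<delta> w s0 s1 i * moment_rec f \<delta> w s0 s1 (j - 1 - i)))"

definition moment :: "complex \<Rightarrow> (int \<Rightarrow> complex) \<Rightarrow> (int \<Rightarrow> complex) \<Rightarrow> (int \<Rightarrow> complex)
    \<Rightarrow> nat \<Rightarrow> complex" where
  "moment f d us vs =
     moment_rec f (d 1) (vs 0) (us 1 / 2) (- (us 1 / 2) * vs 1)"

definition moment_dagger :: "complex \<Rightarrow> (int \<Rightarrow> complex) \<Rightarrow> (int \<Rightarrow> complex)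
    \<Rightarrow> (int \<Rightarrow> complex) \<Rightarrow> nat \<Rightarrow> complex" where
  "moment_dagger f d us vs =
     moment_rec f (d 0) (vs 0) (- us (-1) / 2) (- (- us (-1) / 2) * vs (-1))"

text \<open>Matrix indices start at 0 in the library, hence \<open>s (i + j)\<close>.\<close>

definition hankel_det :: "(nat \<Rightarrow> complex) \<Rightarrow> nat \<Rightarrow> complex" where
  "hankel_det s n = det (mat n n (\<lambda>(i, j). s (i + j)))"

lemma hankel_det_0: "hankel_det s 0 = 1"
  by (simp add: hankel_det_def)

lemma curve_Y_ex1:
  "\<exists>!y. y\<^sup>2 = at_inf (curve_poly f u v) \<and> fls_subdegree y = -2 \<and> fls_nth y (-2) = 1"
proof (rule ex_ex1I)
  define G :: "complex fps" where
    "G = 1 + fps_const (2 * f) * fps_X\<^sup>2 + fps_const (4 * u) * fps_X ^ 3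
         + fps_const (f\<^sup>2 - 4 * u * v) * fps_X ^ 4"
  define r where "r = fps_radical (\<lambda>_ _. 1) (Suc 1) G"
  have G0: "fps_nth G 0 = 1" by (simp add: G_def power2_eq_square eval_nat_numeral)
  have r2: "r ^ Suc 1 = G"
    unfolding r_def using power_radical[of G "\<lambda>_ _. 1" 1] G0 by simp
  have r0: "fps_nth r 0 = 1" by (simp add: r_def)
  define y :: "complex fls" where "y = fls_X_inv\<^sup>2 * fps_to_fls r"
  have inv: "(fls_X :: complex fls) * fls_X_inv = 1"
    by (metis fls_inverse_X_inv fls_X_inv_nonzero left_inverse)
  have inv2: "fls_X * (fls_X_inv * z) = z" for z :: "complex fls"
    using inv by (metis mult.assoc mult_1)
  have F: "at_inf (curve_poly f u v) = fls_X_inv ^ 4 * fps_to_fls G"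
  proof -
    have c: "curve_poly f u v = [:f\<^sup>2 - 4 * u * v, 4 * u, 2 * f, 0, 1:]"
      by (simp add: curve_poly_def power2_eq_square algebra_simps)
    have "at_inf (curve_poly f u v)
        = fls_const (f\<^sup>2 - 4 * u * v) + fls_X_inv * fls_const (4 * u)
          + fls_X_inv\<^sup>2 * fls_const (2 * f) + fls_X_inv ^ 4"
      unfolding at_inf_def c
      by (simp add: map_poly_pCons algebra_simps eval_nat_numeral)
    also have "\<dots> = fls_X_inv ^ 4 * fps_to_fls G"
      unfolding G_def
      by (simp add: fls_times_fps_to_fls fps_to_fls_power algebra_simps eval_nat_numeral
          inv2 inv mult.left_commute[of fls_X_inv fls_X])
    finally show ?thesis .
  qed
  have "y\<^sup>2 = fls_X_inv ^ 4 * fps_to_fls (r ^ Suc 1)"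
    by (simp add: y_def power_mult_distrib fps_to_fls_power fls_times_fps_to_fls
        eval_nat_numeral algebra_simps)
  moreover have y_shift: "y = fls_shift 2 (fps_to_fls r)"
    by (simp add: y_def fls_X_inv_power_conv_shift_1 fls_shifted_times_simps)
  have "fls_nth y (-2) = 1"
    by (simp add: y_shift r0)
  moreover have "fls_subdegree y = -2"
    by (rule fls_subdegree_eqI) (auto simp: y_shift r0)
  ultimately show
    "\<exists>y. y\<^sup>2 = at_inf (curve_poly f u v) \<and> fls_subdegree y = -2 \<and> fls_nth y (-2) = 1"
    using F r2 by auto
next
  fix y z :: "complex fls"
  assume y: "y\<^sup>2 = at_inf (curve_poly f u v) \<and> fls_subdegree y = -2 \<and> fls_nth y (-2) = 1"
     and z: "z\<^sup>2 = at_inf (curve_poly f u v) \<and> fls_subdegree z = -2 \<and> fls_nth z (-2) = 1"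
  then have "y = z \<or> y = - z" by (metis power2_eq_iff)
  moreover have "y \<noteq> - z"
  proof
    assume "y = - z"
    then have "fls_nth y (-2) = - fls_nth z (-2)" by simp
    then show False using y z by simp
  qed
  ultimately show "y = z" by simp
qed

lemma genus_one_data_recurrences:
  assumes "genus_one_data f u v d us vs"
  shows "4 * d n + us n * us (n - 1) = 0"
    and "d (n + 1) = - d n - (vs n)\<^sup>2 - f"
    and "vs (n + 1) = - vs n - u / (d n + (vs n)\<^sup>2 + f)"
proof -
  have F: "curve_poly f u v = (cf_P f d n)\<^sup>2 + cf_Q us vs n * cf_Q us vs (n - 1)"
    and R: "[:vs n, 1:] * cf_Q us vs n = Polynomial.smult (us n / 2) (cf_P f d (n + 1) + cf_P f d n)"
    and un: "us n \<noteq> 0" and dn: "d n \<noteq> 0" for n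
    using assms by (auto simp: genus_one_data_def)
  show q: "4 * d n + us n * us (n - 1) = 0" for n
    using arg_cong[OF F[of n], of "\<lambda>p. coeff p 2"]
    by (simp add: curve_poly_def cf_P_def cf_Q_def power2_eq_square eval_nat_numeral algebra_simps)
  have "us n * (- (vs n * vs n)) * 2 = us n * (2 * f + 2 * d n + 2 * d (n + 1))" for n
    using arg_cong[OF R[of n], of "\<lambda>p. coeff p 0"]
    by (simp add: cf_P_def cf_Q_def field_simps)
  then have h: "- (vs n * vs n) * 2 = 2 * f + 2 * d n + 2 * d (n + 1)" for n
    using un[of n] by (metis mult.assoc mult_left_cancel)
  have solve: "y = - x - a\<^sup>2 - f" if "- (a * a) * 2 = 2 * f + 2 * x + 2 * y" for a x y :: complex
  proof -
    have "2 * (y - (- x - a\<^sup>2 - f)) = 2 * f + 2 * x + 2 * y - (- (a * a) * 2)"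
      by (simp add: power2_eq_square algebra_simps)
    also have "\<dots> = 0" by (simp only: that diff_self)
    finally have "y - (- x - a\<^sup>2 - f) = 0" by (simp only: mult_eq_0_iff) simp
    then show ?thesis by (simp only: right_minus_eq)
  qed
  show e: "d (n + 1) = - d n - (vs n)\<^sup>2 - f" for n
    by (rule solve) (rule h)
  have c1: "4 * u + us n * (us (n + 1) * vs (n + 1)) = - (us n * (vs n * us (n + 1)))" for n
    using arg_cong[OF F[of "n+1"], of "\<lambda>p. coeff p 1"]
    by (simp add: curve_poly_def cf_P_def cf_Q_def power2_eq_square algebra_simps)
  have c2: "us (n + 1) * us n = - (4 * d (n + 1))"
    using q[of "n+1"] by (simp add: add_eq_0_iff)
  have "4 * u = - (us n * (vs n * us (n + 1))) - us n * (us (n + 1) * vs (n + 1))"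
    using c1[of n] by (simp only: eq_diff_eq)
  also have "\<dots> = - (us (n + 1) * us n) * (vs n + vs (n + 1))"
    by (simp add: algebra_simps)
  finally have "4 * u = 4 * (d (n+1) * (vs n + vs (n + 1)))"
    by (simp only: c2 minus_minus mult.assoc)
  then have "u = d (n+1) * (vs n + vs (n + 1))"
    by simp
  then have "vs (n + 1) = - vs n + u / d (n + 1)"
    using dn[of "n+1"] by (simp add: field_simps)
  also have "d (n + 1) = - (d n + (vs n)\<^sup>2 + f)" by (simp add: e)
  finally show "vs (n + 1) = - vs n - u / (d n + (vs n)\<^sup>2 + f)"
    by (simp only: divide_minus_right add_uminus_conv_diff)
qed

end

theory Submission
  imports Defs
begin

text \<open>
  The moments \<open>s\<close> are the coefficients of \<open>1 / Y\<^sub>1\<close>: their recursion is the quadratic equation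
  \<open>Q\<^sub>0 G\<^sup>2 + 2 P\<^sub>1 G = Q\<^sub>1\<close> in coefficients.  Since \<open>1 / Y\<^sub>k\<close> determines \<open>1 / Y\<^bsub>k+1\<^esub>\<close> by a division step, they
  have a J-fraction whose coefficients are the \<open>d\<^sub>k\<close>, so that
  \<open>\<Delta>\<^bsub>n+2\<^esub> \<Delta>\<^sub>n = d\<^bsub>n+2\<^esub> \<Delta>\<^bsub>n+1\<^esub>\<^sup>2\<close>.  The Somos-4 relation for \<open>\<Delta>\<close> is therefore equivalent to
  \<open>d\<^bsub>n-1\<^esub> d\<^sub>n\<^sup>2 d\<^bsub>n+1\<^esub> = u\<^sup>2 (d\<^sub>n + v\<^sup>2 + f)\<close>, which follows from the equation of the curve.
  Conversely, a Somos-4 sequence \<open>\<tau>\<close> yields \<open>d\<^sub>n = \<tau>\<^sub>n \<tau>\<^bsub>n-2\<^esub> / \<tau>\<^bsub>n-1\<^esub>\<^sup>2\<close>, from which all other data are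
  solved for; a sequence is determined by these ratios up to a factor \<open>a b\<^sup>n\<close>.  Negative indices
  reduce to positive ones by the symmetry \<open>(d\<^sub>n, u\<^sub>n, v\<^sub>n) \<mapsto> (d\<^bsub>1-n\<^esub>, -u\<^bsub>-n\<^esub>, v\<^bsub>-n\<^esub>)\<close>.
\<close>

section \<open>Hankel determinants of J-fractions\<close>

text \<open>In generating functions the recursion reads \<open>S(x) R(x) = s 0\<close> with
  \<open>R = 1 + v x + x^2 T\<close>. The claim compares coefficients of \<open>x^i y^j\<close>
  after substituting this into \<open>S(x) S(y) - s 0 (x S(x) - y S(y)) / (x - y)\<close>. The
  induction passes from \<open>(i, Suc j)\<close> to \<open>(Suc i, j)\<close>.\<close>

lemma jfraction_hankel_entry:
  fixes s t :: "nat \<Rightarrow> 'a :: comm_ring_1"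
  assumes rec: "\<And>m. s (Suc m) = - v * s m - (\<Sum>p<m. s (m - 1 - p) * t p)"
  shows "s i * s j - s 0 * s (i + j)
           = (\<Sum>p<i. \<Sum>q<j. s (i - 1 - p) * t (p + q) * s (j - 1 - q))"
proof (induction i arbitrary: j)
  case 0
  show ?case by simp
next
  case (Suc i)
  \<comment> \<open>\<open>?K\<close> is the common rest of the double sums for
    \<open>(i, Suc j)\<close> and \<open>(Suc i, j)\<close> once the terms with \<open>q = 0\<close>
    and \<open>p = 0\<close>, respectively, are split off.\<close>
  let ?K = "\<Sum>p<i. \<Sum>q<j. s (i - 1 - p) * t (Suc (p + q)) * s (j - 1 - q)"
  have left: "(\<Sum>p<i. \<Sum>q<Suc j. s (i - 1 - p) * t (p + q) * s (Suc j - 1 - q))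
      = s j * (\<Sum>p<i. s (i - 1 - p) * t p) + ?K"
    by (simp add: sum.lessThan_Suc_shift sum.distrib sum_distrib_left mult_ac del: sum.lessThan_Suc)
  have right: "(\<Sum>p<Suc i. \<Sum>q<j. s (Suc i - 1 - p) * t (p + q) * s (j - 1 - q))
      = s i * (\<Sum>q<j. s (j - 1 - q) * t q) + ?K"
    by (simp add: sum.lessThan_Suc_shift sum_distrib_left mult_ac del: sum.lessThan_Suc)
  have "s (Suc i) * s j - s 0 * s (Suc i + j)
      = (s i * s (Suc j) - s 0 * s (i + Suc j)) + (s (Suc i) * s j - s i * s (Suc j))"
    by simp
  also have "s i * s (Suc j) - s 0 * s (i + Suc j)
      = s j * (\<Sum>p<i. s (i - 1 - p) * t p) + ?K"
    by (simp only: Suc.IH left)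
  \<comment> \<open>The \<open>v\<close> terms cancel; what is left are exactly the split-off
    boundary terms.\<close>
  also have "s (Suc i) * s j - s i * s (Suc j)
      = s i * (\<Sum>q<j. s (j - 1 - q) * t q) - s j * (\<Sum>p<i. s (i - 1 - p) * t p)"
    unfolding rec by (simp add: algebra_simps)
  finally show ?case
    by (simp only: right) (simp add: algebra_simps)
qed

lemma det_hankel_bordered:
  "det (mat (Suc n) (Suc n) (\<lambda>(i, j). if i = 0 \<and> j = 0 then 1
          else if i = 0 \<or> j = 0 then 0 else - t (i + j - 2))) = (-1) ^ n * hankel_det t n"
    (is "det ?B = _")
proof -
  let ?H = "mat n n (\<lambda>(i, j). t (i + j))"
  have "?B = four_block_mat (1\<^sub>m 1) (0\<^sub>m 1 n) (0\<^sub>m n 1) (- 1 \<cdot>\<^sub>m ?H)"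
    by (intro eq_matI) (auto simp: four_block_mat_def Let_def numeral_2_eq_2)
  moreover have "det (four_block_mat (1\<^sub>m 1) (0\<^sub>m 1 n) (0\<^sub>m n 1) (- 1 \<cdot>\<^sub>m ?H)) = det (1\<^sub>m 1 :: complex mat) * det (- 1 \<cdot>\<^sub>m ?H)"
    by (intro det_four_block_mat_lower_left_zero[of _ 1 _ n]) simp_all
  ultimately have "det ?B = det (1\<^sub>m 1 :: complex mat) * det (- 1 \<cdot>\<^sub>m ?H)"
    by metis
  then show ?thesis
    by (simp add: hankel_det_def)
qed

text \<open>The entry identity says that \<open>s 0\<close> times the Hankel matrix of \<open>s\<close> is \<open>L B L\<^sup>T\<close>, with \<open>L\<close>
  the lower triangular Toeplitz matrix of \<open>s\<close> and \<open>B\<close> the block sum of \<open>1\<close> and minus the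
  Hankel matrix of \<open>t\<close>.\<close>

lemma hankel_det_Suc_jfraction:
  assumes rec: "\<And>m. s (Suc m) = - v * s m - (\<Sum>p<m. s (m - 1 - p) * t p)"
    and s0: "s 0 \<noteq> 0"
  shows "hankel_det s (Suc n) = (-1) ^ n * s 0 ^ Suc n * hankel_det t n"
proof -
  let ?N = "Suc n"
  define L where "L = mat ?N ?N (\<lambda>(i, j). if j \<le> i then s (i - j) else 0)"
  define B where "B = mat ?N ?N (\<lambda>(i, j). if i = 0 \<and> j = 0 then 1
          else if i = 0 \<or> j = 0 then 0 else - t (i + j - 2))"
  define H where "H = mat ?N ?N (\<lambda>(i, j). s (i + j))"
  have carr: "L \<in> carrier_mat ?N ?N" "B \<in> carrier_mat ?N ?N" "H \<in> carrier_mat ?N ?N"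
    by (simp_all add: L_def B_def H_def)
  have entry: "(\<Sum>p<?N. L $$ (i, p) * (\<Sum>q<?N. B $$ (p, q) * L $$ (j, q))) = s 0 * s (i + j)"
    if ij: "i < ?N" "j < ?N" for i j
  proof -
    have "(\<Sum>p<?N. L $$ (i, p) * (\<Sum>q<?N. B $$ (p, q) * L $$ (j, q)))
        = (\<Sum>p<?N. \<Sum>q<?N. L $$ (i, p) * B $$ (p, q) * L $$ (j, q))"
      by (simp only: sum_distrib_left mult.assoc)
    also have "\<dots> = (\<Sum>p<Suc i. \<Sum>q<Suc j. L $$ (i, p) * B $$ (p, q) * L $$ (j, q))"
      using ij by (intro sum.mono_neutral_cong_right ballI sum.neutral) (auto simp: L_def)
    \<comment> \<open>The corner \<open>p = q = 0\<close> gives \<open>s i * s j\<close>, the rest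
      of the first row and column of \<open>B\<close> vanishes, and the block of \<open>- t\<close>
      gives the double sum.\<close>
    also have "\<dots> = s i * s j - (\<Sum>p<i. \<Sum>q<j. s (i - 1 - p) * t (p + q) * s (j - 1 - q))"
      using ij by (simp add: sum.lessThan_Suc_shift L_def B_def sum_negf del: sum.lessThan_Suc)
    also have "\<dots> = s 0 * s (i + j)"
      unfolding jfraction_hankel_entry[OF rec, symmetric] by simp
    finally show ?thesis .
  qed
  have "L * B * transpose_mat L = s 0 \<cdot>\<^sub>m H"
  proof (rule eq_matI)
    fix i j assume "i < dim_row (s 0 \<cdot>\<^sub>m H)" "j < dim_col (s 0 \<cdot>\<^sub>m H)"
    then have ij: "i < ?N" "j < ?N" by (simp_all add: H_def)
    then have "(L * B * transpose_mat L) $$ (i, j)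
        = (\<Sum>p<?N. L $$ (i, p) * (\<Sum>q<?N. B $$ (p, q) * L $$ (j, q)))"
      using carr by (simp add: scalar_prod_def lessThan_atLeast0 del: sum.op_ivl_Suc)
    then show "(L * B * transpose_mat L) $$ (i, j) = (s 0 \<cdot>\<^sub>m H) $$ (i, j)"
      using entry[OF ij] ij by (simp add: H_def)
  qed (use carr in auto)
  then have "det L * det B * det L = s 0 ^ ?N * det H"
    using carr det_mult[of "L * B" ?N "transpose_mat L"] det_mult[OF carr(1,2)] det_transpose[OF carr(1)]
    by (simp add: det_smult)
  moreover have "det L = s 0 ^ ?N"
  proof -
    have "det L = prod_list (diag_mat L)"
      by (rule det_lower_triangular[OF _ carr(1)]) (auto simp: L_def)
    also have "\<dots> = (\<Prod>i = 0..<?N. L $$ (i, i))"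
      unfolding prod_list_diag_prod by (simp add: L_def)
    also have "\<dots> = (\<Prod>i = 0..<?N. s 0)"
      by (rule prod.cong) (auto simp: L_def)
    finally show ?thesis by simp
  qed
  moreover have "det B = (-1) ^ n * hankel_det t n"
    unfolding B_def by (rule det_hankel_bordered)
  moreover have "det H = hankel_det s ?N"
    by (simp add: H_def hankel_det_def)
  \<comment> \<open>\<open>det L\<close> enters twice on the left, so one factor
    \<open>s 0 ^ ?N\<close> survives the cancellation.\<close>
  ultimately have "s 0 ^ ?N * ((-1) ^ n * s 0 ^ ?N * hankel_det t n) = s 0 ^ ?N * hankel_det s ?N"
    by (simp only: mult_ac)
  then show ?thesis
    using s0 by (simp only: mult_cancel_left) simp
qed

lemma hankel_det_scale: "hankel_det (\<lambda>i. c * s i) n = c ^ n * hankel_det s n"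
proof -
  have "mat n n (\<lambda>(i, j). c * s (i + j)) = c \<cdot>\<^sub>m mat n n (\<lambda>(i, j). s (i + j))"
    by (intro eq_matI) auto
  then show ?thesis
    by (simp add: hankel_det_def)
qed

section \<open>The moments of the complete quotients\<close>

text \<open>Apart from the leading \<open>S\<close>, every occurrence of \<open>S\<close> carries a
  factor \<open>fps_X\<^sup>2\<close>, so coefficient \<open>j + 2\<close> is fixed by those up to
  \<open>j\<close>. The resulting uniqueness later recognises a tail of the continued fraction as a
  moment series.\<close>

lemma moment_equation_iff:
  fixes S :: "complex fps"
  shows "(1 + fps_const (2 * \<delta> + f) * fps_X\<^sup>2) * S
           = fps_const s0 + fps_const s1 * fps_X
             + fps_const (inverse s0 * \<delta>) * (fps_X\<^sup>2 - fps_const w * fps_X ^ 3) * S\<^sup>2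
         \<longleftrightarrow> S = Abs_fps (moment_rec f \<delta> w s0 s1)" (is "?l S = ?r S \<longleftrightarrow> _")
proof -
  have l: "fps_nth (?l S) n = fps_nth S n + (2 * \<delta> + f) * (if n < 2 then 0 else fps_nth S (n - 2))"
    for n and S :: "complex fps"
    by (simp add: distrib_right mult.assoc fps_X_power_mult_nth)
  have r: "fps_nth (?r S) n = (if n = 0 then s0 else 0) + (if n = 1 then s1 else 0)
      + inverse s0 * \<delta> * ((if n < 2 then 0 else fps_nth (S * S) (n - 2))
                    - w * (if n < 3 then 0 else fps_nth (S * S) (n - 3)))"
    for n and S :: "complex fps"
    by (simp add: left_diff_distrib mult.assoc fps_X_power_mult_nth power2_eq_square[of S])
  have eq_rec: "?l S = ?r S \<longleftrightarrow> fps_nth S 0 = s0 \<and> fps_nth S 1 = s1 \<and>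
    (\<forall>j. fps_nth S (j + 2) = - (2 * \<delta> + f) * fps_nth S j + inverse s0 * \<delta> *
       ((\<Sum>i\<le>j. fps_nth S i * fps_nth S (j - i))
         - w * (\<Sum>i<j. fps_nth S i * fps_nth S (j - 1 - i))))" (is "_ \<longleftrightarrow> ?rec S") for S
  proof -
    have all: "(\<forall>n. P n) \<longleftrightarrow> P 0 \<and> P 1 \<and> (\<forall>j. P (j + 2))" for P :: "nat \<Rightarrow> bool"
      by (metis One_nat_def add_2_eq_Suc' not0_implies_Suc)
    \<comment> \<open>At \<open>j = 0\<close> the guard on the left matches the empty sum on the
      right, so the truncated \<open>j - 1\<close> does no harm.\<close>
    have sh: "(if j + 2 < 3 then 0 else fps_nth (S * S) (j + 2 - 3))
        = (\<Sum>i<j. fps_nth S i * fps_nth S (j - 1 - i))" for j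
      by (cases j) (auto simp: fps_mult_nth lessThan_Suc_atMost atMost_atLeast0)
    have sq: "fps_nth (S * S) j = (\<Sum>i\<le>j. fps_nth S i * fps_nth S (j - i))" for j
      by (simp add: fps_mult_nth atMost_atLeast0)
    have mv: "a + b = c \<longleftrightarrow> a = - b + c" for a b c :: complex
      by (auto simp: algebra_simps)
    show ?thesis
      unfolding fps_eq_iff l r
      apply (subst all)
      unfolding sh
      by (simp add: sq mv) (simp add: algebra_simps)
  qed
  have nth: "fps_nth S n = moment_rec f \<delta> w s0 s1 n" if "?rec S" for n
    using that
  proof (induction n rule: less_induct)
    case (less n)
    have IH: "fps_nth S i = moment_rec f \<delta> w s0 s1 i" if "i < n" for i
      by (rule less.IH[OF that less.prems])
    consider "n = 0" | "n = 1" | j where "n = Suc (Suc j)"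
      by (metis One_nat_def not0_implies_Suc)
    then show ?case
    proof cases
      case 3
      have "fps_nth S n = - (2 * \<delta> + f) * fps_nth S j + inverse s0 * \<delta> *
        ((\<Sum>i\<le>j. fps_nth S i * fps_nth S (j - i))
         - w * (\<Sum>i<j. fps_nth S i * fps_nth S (j - 1 - i)))"
        using less.prems 3 by simp
      also have "\<dots> = moment_rec f \<delta> w s0 s1 n"
        unfolding 3 moment_rec.simps by (intro arg_cong2[where f = "(+)"] arg_cong2[where f = "(*)"]
            arg_cong2[where f = "(-)"] sum.cong refl IH) (auto simp: 3)
      finally show ?thesis .
    qed (use less.prems in simp_all)
  qed
  have "S = Abs_fps (moment_rec f \<delta> w s0 s1)" if "?rec S"
    by (rule fps_ext, subst fps_nth_Abs_fps) (rule nth[OF that])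
  moreover have "?rec S" if "S = Abs_fps (moment_rec f \<delta> w s0 s1)"
    unfolding that by simp
  ultimately show ?thesis
    unfolding eq_rec by (rule iffI)
qed

text \<open>Here \<open>x = 1 / X\<close>, \<open>c = u\<^sub>k / 2\<close> and \<open>w = v\<^bsub>k-1\<^esub>\<close>; the first hypothesis is
  \<open>Q\<^bsub>k-1\<^esub> G\<^sup>2 + 2 P\<^sub>k G = Q\<^sub>k\<close> for \<open>G = x S\<close>, and the conclusion is the same equation for \<open>k + 1\<close>.\<close>

lemma complete_quotient_step:
  fixes x :: "'a :: idom"
  assumes S: "c * ((1 + (2 * d + f) * x\<^sup>2) * S) = c * (c - c * v * x) + d * (x\<^sup>2 - w * x ^ 3) * S\<^sup>2"
    and SR: "S * R = c" and R: "R = 1 + v * x + c * x\<^sup>2 * T"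
    and d': "d' = - d - v\<^sup>2 - f" and u: "d * (v + w) = d' * (v' + v)" and cc: "c * c' = - d'"
    and nz: "c \<noteq> 0" "x \<noteq> 0"
  shows "(1 + (2 * d' + f) * x\<^sup>2) * T = c' - c' * v' * x - c * (x\<^sup>2 - v * x ^ 3) * T\<^sup>2"
proof -
  \<comment> \<open>Multiplying by \<open>R\<^sup>2\<close> and using \<open>S * R = c\<close> turns
    the quadratic equation for \<open>S\<close> into one for its reciprocal.\<close>
  have 1: "(1 + (2 * d + f) * x\<^sup>2) * R = (1 - v * x) * R\<^sup>2 + d * (x\<^sup>2 - w * x ^ 3)"
  proof -
    have "c\<^sup>2 * ((1 + (2 * d + f) * x\<^sup>2) * R) = c * ((1 + (2 * d + f) * x\<^sup>2) * S) * R\<^sup>2"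
      unfolding SR[symmetric] by (simp add: power2_eq_square algebra_simps)
    also have "\<dots> = c\<^sup>2 * (1 - v * x) * R\<^sup>2 + d * (x\<^sup>2 - w * x ^ 3) * (S * R)\<^sup>2"
      unfolding S by (simp add: power2_eq_square algebra_simps)
    also have "\<dots> = c\<^sup>2 * ((1 - v * x) * R\<^sup>2 + d * (x\<^sup>2 - w * x ^ 3))"
      unfolding SR by (simp add: algebra_simps)
    finally show ?thesis using nz by simp
  qed
  \<comment> \<open>After substituting \<open>R\<close> and \<open>d'\<close>, the equations for
    \<open>R\<close> and for \<open>T\<close> differ only by two defects, which \<open>u\<close> and
    \<open>cc\<close> remove.\<close>
  have "c * x\<^sup>2 * ((1 + (2 * d' + f) * x\<^sup>2) * T - (c' - c' * v' * x - c * (x\<^sup>2 - v * x ^ 3) * T\<^sup>2))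
      = x ^ 3 * (d * (v + w) - d' * (v' + v)) - (c * c' + d') * (x\<^sup>2 - v' * x ^ 3)
        - ((1 + (2 * d + f) * x\<^sup>2) * R - ((1 - v * x) * R\<^sup>2 + d * (x\<^sup>2 - w * x ^ 3)))"
    unfolding R d' by (simp add: power2_eq_square power3_eq_cube algebra_simps)
  also have "\<dots> = 0"
    by (simp add: 1 u cc)
  finally have "(1 + (2 * d' + f) * x\<^sup>2) * T - (c' - c' * v' * x - c * (x\<^sup>2 - v * x ^ 3) * T\<^sup>2) = 0"
    using nz by (simp only: mult_eq_0_iff) simp
  then show ?thesis by simp
qed

text \<open>The coefficients of \<open>X^2\<close>, \<open>X\<close> and \<open>1\<close> in
  \<open>F = P_n^2 + Q_n Q_(n-1)\<close> are \<open>us_mult\<close>, \<open>vs_add\<close> and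
  \<open>vs_mult\<close>; \<open>d_add\<close> is the relation for \<open>(X + v_n) Q_n\<close>. In
  this form the data are easy to reverse and to construct.\<close>

locale somos_data =
  fixes f u v :: complex and d us vs :: "int \<Rightarrow> complex"
  assumes us_nonzero: "us n \<noteq> 0"
    and d_nonzero: "d n \<noteq> 0"
    and us_mult: "us n * us (n - 1) = - 4 * d n"
    and d_add: "d (n + 1) + d n = - (vs n)\<^sup>2 - f"
    and vs_add: "d n * (vs n + vs (n - 1)) = u"
    and vs_mult: "d n * (vs n * vs (n - 1) - f - d n) = u * v"
begin

text \<open>Eliminating both neighbours by \<open>d_add\<close> leaves a case of
  \<open>(a^2 + e) (b^2 + e) = (a b - e)^2 + e (a + b)^2\<close> with \<open>e = d n + f\<close>;
  the two squares are then known from \<open>vs_mult\<close> and \<open>vs_add\<close>.\<close>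

lemma d_step: "d (n - 1) * (d n)\<^sup>2 * d (n + 1) = u\<^sup>2 * (d n + (v\<^sup>2 + f))"
proof -
  have 1: "d (n + 1) = - (vs n)\<^sup>2 - f - d n"
    using d_add[of n] by (simp add: eq_diff_eq)
  have 2: "d (n - 1) = - (vs (n - 1))\<^sup>2 - f - d n"
    using d_add[of "n - 1"] by (simp add: eq_diff_eq add.commute)
  have "d (n - 1) * (d n)\<^sup>2 * d (n + 1)
      = (d n * (vs n * vs (n - 1) - f - d n))\<^sup>2 + (d n + f) * (d n * (vs n + vs (n - 1)))\<^sup>2"
    unfolding 1 2 by (simp add: power2_eq_square algebra_simps)
  also have "\<dots> = u\<^sup>2 * (d n + (v\<^sup>2 + f))"
    unfolding vs_mult vs_add by (simp add: power2_eq_square algebra_simps)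
  finally show ?thesis .
qed

text \<open>The sign of \<open>us\<close> cancels in products of neighbours; it is chosen so that
  \<open>moment_dagger\<close> becomes the \<open>moment\<close> of the reversed data.\<close>

lemma reversed: "somos_data f u v (\<lambda>k. d (1 - k)) (\<lambda>k. - us (- k)) (\<lambda>k. vs (- k))"
proof
  fix n
  show "- us (- n) \<noteq> 0" "d (1 - n) \<noteq> 0"
    by (simp_all add: us_nonzero d_nonzero)
  show "- us (- n) * - us (- (n - 1)) = - 4 * d (1 - n)"
    using us_mult[of "1 - n"] by (simp add: mult.commute)
  show "d (1 - (n + 1)) + d (1 - n) = - (vs (- n))\<^sup>2 - f"
    using d_add[of "- n"] by (simp add: add.commute)
  show "d (1 - n) * (vs (- n) + vs (- (n - 1))) = u"
    using vs_add[of "1 - n"] by (simp add: add.commute)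
  show "d (1 - n) * (vs (- n) * vs (- (n - 1)) - f - d (1 - n)) = u * v"
    using vs_mult[of "1 - n"] by (simp add: mult.commute)
qed

text \<open>The moments of the complete quotient \<open>Y\<^sub>k\<close>: \<open>1 / Y\<^sub>k\<close> expands as \<open>\<Sum>j. mom k j * X\<^bsup>-j-1\<^esup>\<close>.\<close>

definition mom :: "int \<Rightarrow> nat \<Rightarrow> complex" where
  "mom k = moment_rec f (d k) (vs (k - 1)) (us k / 2) (- (us k / 2) * vs k)"

lemma mom_0: "mom k 0 = us k / 2"
  by (simp add: mom_def)

text \<open>This is the step \<open>Y_k = a_k + 1 / Y_(k+1)\<close> in coefficients: the series of
  \<open>mom k\<close> times a multiple of its inverse is constant, and the tail of that inverse is
  the series of \<open>mom (k + 1)\<close>.\<close>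

lemma mom_jfraction:
  "mom k (Suc m) = - vs k * mom k m - (\<Sum>p<m. mom k (m - 1 - p) * (us k / 2 * mom (k + 1) p))"
proof -
  have const2: "fps_const (2 * a + b) = 2 * fps_const a + fps_const b" for a b :: complex
    by (simp only: mult_2 flip: fps_const_add)
  define c where "c = us k / 2"
  define c' where "c' = us (k + 1) / 2"
  have c: "c \<noteq> 0" "c' \<noteq> 0"
    by (simp_all add: c_def c'_def us_nonzero)
  have cc: "c * c' = - d (k + 1)"
    using us_mult[of "k + 1"] by (simp add: c_def c'_def mult.commute)
  have S_eq: "(1 + fps_const (2 * d k + f) * fps_X\<^sup>2) * Abs_fps (mom k)
      = fps_const c + fps_const (- c * vs k) * fps_X
        + fps_const (inverse c * d k) * (fps_X\<^sup>2 - fps_const (vs (k - 1)) * fps_X ^ 3) * (Abs_fps (mom k))\<^sup>2"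
    unfolding mom_def c_def moment_equation_iff by simp
  define S where "S = Abs_fps (mom k)"
  \<comment> \<open>\<open>R\<close> stands for \<open>c * Y_k / X\<close>. As
    \<open>a_k = (X + v_k) / c\<close>, it should begin with \<open>1 + v_k / X\<close>, and
    \<open>T\<close> is the remainder divided by \<open>c / X^2\<close>.\<close>
  define R where "R = fps_const c * inverse S"
  define T where "T = fps_const (inverse c) * fps_shift 2 R"
  have S0: "fps_nth S 0 = c" and S1: "fps_nth S 1 = - c * vs k"
    by (simp_all add: S_def c_def mom_def)
  have SR: "S * R = fps_const c"
    using c S0 inverse_mult_eq_1'[of S] by (simp add: R_def mult.left_commute)
  have R0: "fps_nth R 0 = 1"
    using c S0 by (simp add: R_def)
  have R1: "fps_nth R 1 = vs k"
    using arg_cong[OF SR, of "\<lambda>A. fps_nth A 1"] c S0 S1 R0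
    by (simp add: fps_mult_nth)
  have R: "R = 1 + fps_const (vs k) * fps_X + fps_const c * fps_X\<^sup>2 * T"
  proof (rule fps_ext)
    fix n
    consider "n = 0" | "n = 1" | j where "n = Suc (Suc j)"
      by (metis One_nat_def not0_implies_Suc)
    then show "fps_nth R n = fps_nth (1 + fps_const (vs k) * fps_X + fps_const c * fps_X\<^sup>2 * T) n"
      by cases (use R0 R1 c in \<open>simp_all add: mult.assoc fps_X_power_mult_nth T_def\<close>)
  qed
  have "(1 + (2 * fps_const (d (k + 1)) + fps_const f) * fps_X\<^sup>2) * T
      = fps_const c' - fps_const c' * fps_const (vs (k + 1)) * fps_X
        - fps_const c * (fps_X\<^sup>2 - fps_const (vs k) * fps_X ^ 3) * T\<^sup>2"
  proof (rule complete_quotient_step[where d = "fps_const (d k)" and w = "fps_const (vs (k - 1))", OF _ SR R])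
    have "fps_const c * ((1 + fps_const (2 * d k + f) * fps_X\<^sup>2) * S)
      = fps_const c * (fps_const c + fps_const (- c * vs k) * fps_X)
        + fps_const (c * (inverse c * d k)) * (fps_X\<^sup>2 - fps_const (vs (k - 1)) * fps_X ^ 3) * S\<^sup>2"
      unfolding S_def S_eq by (simp only: distrib_left mult.assoc flip: fps_const_mult)
    also have "c * (inverse c * d k) = d k"
      using c by simp
    finally show "fps_const c * ((1 + (2 * fps_const (d k) + fps_const f) * fps_X\<^sup>2) * S)
      = fps_const c * (fps_const c - fps_const c * fps_const (vs k) * fps_X)
        + fps_const (d k) * (fps_X\<^sup>2 - fps_const (vs (k - 1)) * fps_X ^ 3) * S\<^sup>2"
      by (simp only: const2 mult_minus_left add_uminus_conv_diff flip: fps_const_mult fps_const_neg)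
    have "d (k + 1) = - d k - (vs k)\<^sup>2 - f"
      using d_add[of k] by (simp only: flip: eq_diff_eq) simp
    then show "fps_const (d (k + 1)) = - fps_const (d k) - (fps_const (vs k))\<^sup>2 - fps_const f"
      by (simp only: power2_eq_square fps_const_mult fps_const_sub fps_const_neg)
    show "fps_const (d k) * (fps_const (vs k) + fps_const (vs (k - 1)))
        = fps_const (d (k + 1)) * (fps_const (vs (k + 1)) + fps_const (vs k))"
      using vs_add[of k] vs_add[of "k + 1"] by simp
    show "fps_const c * fps_const c' = - fps_const (d (k + 1))"
      using cc by simp
  qed (use c in simp_all)
  moreover have "inverse c' * d (k + 1) = - c"
    using cc c by (simp add: field_simps)
  ultimately have "(1 + fps_const (2 * d (k + 1) + f) * fps_X\<^sup>2) * T
      = fps_const c' + fps_const (- c' * vs (k + 1)) * fps_X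
        + fps_const (inverse c' * d (k + 1)) * (fps_X\<^sup>2 - fps_const (vs k) * fps_X ^ 3) * T\<^sup>2"
    by (simp only: const2 mult_minus_left add_uminus_conv_diff flip: fps_const_mult fps_const_neg)
  \<comment> \<open>\<open>T\<close> solves the moment equation for \<open>k + 1\<close>, whose
    solution is unique.\<close>
  then have T: "T = Abs_fps (mom (k + 1))"
    unfolding moment_equation_iff by (simp add: mom_def c'_def)
  have "fps_nth (S * R) (Suc m) = mom k (Suc m) + vs k * mom k m
      + c * (\<Sum>p<m. mom (k + 1) p * mom k (m - 1 - p))"
  proof -
    have "S * R = S + fps_const (vs k) * (fps_X * S) + fps_const c * (fps_X\<^sup>2 * (T * S))"
      unfolding R by (simp add: algebra_simps)
    moreover have "fps_nth (fps_X\<^sup>2 * (T * S)) (Suc m) = (\<Sum>p<m. mom (k + 1) p * mom k (m - 1 - p))"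
    proof (cases m)
      case 0
      then show ?thesis by (simp add: fps_X_power_mult_nth)
    next
      case (Suc j)
      then have "fps_nth (fps_X\<^sup>2 * (T * S)) (Suc m) = fps_nth (T * S) j"
        by (simp add: fps_X_power_mult_nth)
      also have "\<dots> = (\<Sum>p = 0..j. mom (k + 1) p * mom k (j - p))"
        by (simp only: fps_mult_nth T S_def fps_nth_Abs_fps)
      also have "\<dots> = (\<Sum>p<m. mom (k + 1) p * mom k (m - 1 - p))"
        by (rule sum.cong) (auto simp: Suc)
      finally show ?thesis .
    qed
    ultimately show ?thesis
      by (simp add: S_def)
  qed
  then have sum_0: "mom k (Suc m) + vs k * mom k m + c * (\<Sum>p<m. mom (k + 1) p * mom k (m - 1 - p)) = 0"
    unfolding SR by simp
  have "mom k (Suc m) = - vs k * mom k m - c * (\<Sum>p<m. mom (k + 1) p * mom k (m - 1 - p))"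
    using sum_0 by (simp only: eq_diff_eq eq_neg_iff_add_eq_0 mult_minus_left) (simp only: add_ac)
  then show ?thesis
    by (simp only: c_def sum_distrib_left mult_ac)
qed

section \<open>Toda and Somos-4 relations for the Hankel determinants\<close>

lemma hankel_mom_Suc:
  "hankel_det (mom k) (Suc n) = (-1) ^ n * (us k / 2) ^ (2 * n + 1) * hankel_det (mom (k + 1)) n"
proof -
  have "hankel_det (mom k) (Suc n) = (-1) ^ n * mom k 0 ^ Suc n * hankel_det (\<lambda>p. us k / 2 * mom (k + 1) p) n"
    by (rule hankel_det_Suc_jfraction[OF mom_jfraction]) (simp add: mom_0 us_nonzero)
  \<comment> \<open>The J-fraction gives \<open>n + 1\<close> factors \<open>us k / 2\<close>;
    pulling the constant out of the shifted moments gives \<open>n\<close> more.\<close>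
  moreover have "x ^ Suc n * x ^ n = x ^ (2 * n + 1)" for x :: complex
    unfolding power_add[symmetric] by (rule arg_cong[of _ _ "(^) x"]) simp
  ultimately show ?thesis
    unfolding hankel_det_scale mom_0 by (metis mult.assoc)
qed

lemma hankel_mom_nonzero: "hankel_det (mom k) n \<noteq> 0"
  by (induction n arbitrary: k) (simp_all add: hankel_det_0 hankel_mom_Suc us_nonzero)

text \<open>Passing from \<open>k\<close> to \<open>k + 1\<close> shortens all determinants by one
  and multiplies both sides by the same power of \<open>us k / 2\<close>, which reduces the claim to
  \<open>us_mult\<close>.\<close>

lemma hankel_mom_toda:
  "hankel_det (mom k) (n + 2) * hankel_det (mom k) n
     = d (k + int n + 1) * (hankel_det (mom k) (n + 1))\<^sup>2"
proof (induction n arbitrary: k)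
  case 0
  have "us (k + 1) * us k = - 4 * d (k + 1)"
    using us_mult[of "k + 1"] by simp
  then have "d (k + 1) = - (us (k + 1) * us k) / 4"
    by simp
  then show ?case
    by (simp add: numeral_2_eq_2 hankel_mom_Suc hankel_det_0 power2_eq_square power3_eq_cube field_simps)
next
  case (Suc n)
  let ?c = "us k / 2"
  let ?H = "hankel_det (mom (k + 1))"
  have sign: "(-1) ^ n * (-1) ^ n = (1 :: complex)" "(-1) ^ (n + 2) = ((-1) ^ n :: complex)"
    by (simp_all flip: power_mult_distrib)
  have exps: "?c ^ (2 * (n + 2) + 1) * ?c ^ (2 * n + 1) = ?c ^ (4 * n + 6)"
    unfolding power_add[symmetric] by (rule arg_cong[of _ _ "(^) ?c"]) simp
  have sq: "(?c ^ (2 * (n + 1) + 1))\<^sup>2 = ?c ^ (4 * n + 6)" "((-1) ^ (n + 1))\<^sup>2 = (1 :: complex)"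
    unfolding power_mult[symmetric] by (rule arg_cong[of _ _ "(^) ?c"]) simp_all
  have "hankel_det (mom k) (Suc n + 2) * hankel_det (mom k) (Suc n)
      = ((-1) ^ n * (-1) ^ n) * (?c ^ (2 * (n + 2) + 1) * ?c ^ (2 * n + 1)) * (?H (n + 2) * ?H n)"
    unfolding add_Suc hankel_mom_Suc[of k n] hankel_mom_Suc[of k "n + 2"] sign(2)
    by (simp only: mult_ac)
  also have "\<dots> = ?c ^ (4 * n + 6) * (?H (n + 2) * ?H n)"
    unfolding exps sign by simp
  also have "\<dots> = ?c ^ (4 * n + 6) * (d (k + 1 + int n + 1) * (?H (n + 1))\<^sup>2)"
    by (simp only: Suc.IH)
  also have "\<dots> = d (k + int (Suc n) + 1) * (hankel_det (mom k) (Suc n + 1))\<^sup>2"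
    unfolding add_Suc hankel_mom_Suc[of k "n + 1"] power_mult_distrib sq by (simp add: add.commute)
  finally show ?case .
qed

text \<open>Three consecutive Toda relations turn the left side, times a nonzero square, into the
  product of \<open>d\<close> evaluated by \<open>d_step\<close>.\<close>

lemma hankel_mom_somos:
  "hankel_det (mom k) (n + 4) * hankel_det (mom k) n
     = u\<^sup>2 * hankel_det (mom k) (n + 3) * hankel_det (mom k) (n + 1)
       + u\<^sup>2 * (v\<^sup>2 + f) * (hankel_det (mom k) (n + 2))\<^sup>2"
proof -
  let ?H = "hankel_det (mom k)"
  define m where "m = k + int n + 2"
  have idx: "k + int n + 1 = m - 1" "k + int (n + 1) + 1 = m" "k + int (n + 2) + 1 = m + 1"
    "n + 1 + 2 = n + 3" "n + 1 + 1 = n + 2" "n + 2 + 2 = n + 4" "n + 2 + 1 = n + 3"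
    by (simp_all add: m_def)
  have t0: "?H (n + 2) * ?H n = d (m - 1) * (?H (n + 1))\<^sup>2"
    using hankel_mom_toda[of k n] idx(1) by (simp only:)
  have t1: "?H (n + 3) * ?H (n + 1) = d m * (?H (n + 2))\<^sup>2"
    using hankel_mom_toda[of k "n + 1"] idx by (simp only:)
  have t2: "?H (n + 4) * ?H (n + 2) = d (m + 1) * (?H (n + 3))\<^sup>2"
    using hankel_mom_toda[of k "n + 2"] idx by (simp only:)
  have "(?H (n + 2))\<^sup>2 * (?H (n + 4) * ?H n) = (?H (n + 4) * ?H (n + 2)) * (?H (n + 2) * ?H n)"
    by (simp add: power2_eq_square)
  also have "\<dots> = d (m - 1) * d (m + 1) * (?H (n + 3) * ?H (n + 1))\<^sup>2"
    unfolding t0 t2 by (simp add: power_mult_distrib)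
  also have "\<dots> = (d (m - 1) * (d m)\<^sup>2 * d (m + 1)) * (?H (n + 2))\<^sup>2 * (?H (n + 2))\<^sup>2"
    unfolding t1 by (simp add: power2_eq_square)
  also have "\<dots> = (?H (n + 2))\<^sup>2 * (u\<^sup>2 * (d m * (?H (n + 2))\<^sup>2) + u\<^sup>2 * (v\<^sup>2 + f) * (?H (n + 2))\<^sup>2)"
    unfolding d_step by (simp add: algebra_simps)
  finally have "?H (n + 4) * ?H n = u\<^sup>2 * (d m * (?H (n + 2))\<^sup>2) + u\<^sup>2 * (v\<^sup>2 + f) * (?H (n + 2))\<^sup>2"
    using hankel_mom_nonzero[of k "n + 2"] by (simp only: mult_cancel_left power_eq_0_iff) simp
  then show ?thesis
    by (simp only: t1[symmetric] mult.assoc)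
qed

lemma moment_eq_mom: "moment f d us vs = mom 1"
  by (simp add: moment_def mom_def)

lemma hankel_moment_nonzero: "hankel_det (moment f d us vs) n \<noteq> 0"
  unfolding moment_eq_mom by (rule hankel_mom_nonzero)

lemma hankel_moment_toda:
  "hankel_det (moment f d us vs) (n + 2) * hankel_det (moment f d us vs) n
     = d (1 + int n + 1) * (hankel_det (moment f d us vs) (n + 1))\<^sup>2"
  unfolding moment_eq_mom by (rule hankel_mom_toda)

lemma hankel_moment_somos:
  "hankel_det (moment f d us vs) (n + 4) * hankel_det (moment f d us vs) n
     = u\<^sup>2 * hankel_det (moment f d us vs) (n + 3) * hankel_det (moment f d us vs) (n + 1)
       + u\<^sup>2 * (v\<^sup>2 + f) * (hankel_det (moment f d us vs) (n + 2))\<^sup>2"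
  unfolding moment_eq_mom by (rule hankel_mom_somos)

end

section \<open>Somos data and the curve\<close>

lemma somos_data_if_genus_one_data:
  assumes "genus_one_data f u v d us vs"
  shows "somos_data f u v d us vs"
proof
  have us: "us n \<noteq> 0" and d: "d n \<noteq> 0"
    and F: "curve_poly f u v = (cf_P f d n)\<^sup>2 + cf_Q us vs n * cf_Q us vs (n - 1)" for n
    using assms by (auto simp: genus_one_data_def)
  note rec = genus_one_data_recurrences[OF assms]
  fix n
  show "us n \<noteq> 0" "d n \<noteq> 0" by fact+
  show um: "us n * us (n - 1) = - 4 * d n"
    using rec(1)[of n] by (simp add: add_eq_0_iff)
  show "d (n + 1) + d n = - (vs n)\<^sup>2 - f"
    using rec(2)[of n] by simp
  have "d (n - 1) + (vs (n - 1))\<^sup>2 + f = - d n"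
    using rec(2)[of "n - 1"] by simp
  then have "vs n = - vs (n - 1) + u / d n"
    using rec(3)[of "n - 1"] by simp
  then show "d n * (vs n + vs (n - 1)) = u"
    using d[of n] by simp
  have "f\<^sup>2 - 4 * u * v = (f + 2 * d n)\<^sup>2 + (us n * us (n - 1)) * (vs n * vs (n - 1))"
    using arg_cong[OF F[of n], of "\<lambda>p. coeff p 0"]
    by (simp add: curve_poly_def cf_P_def cf_Q_def power2_eq_square algebra_simps)
  then have "4 * (d n * (vs n * vs (n - 1) - f - d n)) = 4 * (u * v)"
    unfolding um by (simp add: power2_eq_square algebra_simps)
  then show "d n * (vs n * vs (n - 1) - f - d n) = u * v"
    by simp
qed

section \<open>Expansion at infinity, floors and the continued fraction\<close>

lemma at_inf_pCons: "at_inf (pCons a p) = fls_const a + fls_X_inv * at_inf p"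
  unfolding at_inf_def by (cases "p = 0 \<and> a = 0") (auto simp: map_poly_pCons)

lemma fls_nth_at_inf: "fls_nth (at_inf p) k = (if k \<le> 0 then coeff p (nat (- k)) else 0)"
proof (induction p arbitrary: k)
  case 0
  show ?case by (simp add: at_inf_def)
next
  case (pCons a p)
  have "nat (- k) = Suc (nat (- (k + 1)))" if "k < 0"
    using that by simp
  then show ?case
    by (auto simp: at_inf_pCons fls_X_inv_times_conv_shift pCons.IH)
qed

lemma at_inf_add: "at_inf (p + q) = at_inf p + at_inf q"
  by (rule fls_eqI) (simp add: fls_nth_at_inf)

lemma at_inf_smult: "at_inf (Polynomial.smult c p) = fls_const c * at_inf p"
  by (rule fls_eqI) (simp add: fls_nth_at_inf)

lemma at_inf_mult: "at_inf (p * q) = at_inf p * at_inf q"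
proof (induction p)
  case 0
  show ?case by (simp add: at_inf_def)
next
  case (pCons a p)
  then show ?case
    by (simp add: at_inf_pCons at_inf_add at_inf_smult distrib_right mult.assoc)
qed

lemma coeff_poly_floor: "coeff (poly_floor y) i = fls_nth y (- int i)"
  by (cases i) (auto simp: poly_floor_def)

lemma poly_floor_at_inf_add:
  assumes "1 \<le> fls_subdegree y"
  shows "poly_floor (at_inf p + y) = p"
  using assms by (intro poly_eqI) (simp add: coeff_poly_floor fls_nth_at_inf)

text \<open>The polynomial relations restate the locale assumptions. For the continued fraction,
  \<open>2 (X + v_n) / u_n\<close> leaves the remainder
  \<open>(Y - P_(n+1)) / Q_n = Q_(n+1) / (Y + P_(n+1))\<close>, which vanishes to order 1 at
  infinity.\<close>

lemma (in somos_data) genus_one_data_if_nonzero: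
  assumes u: "u \<noteq> 0"
  shows "genus_one_data f u v d us vs"
proof -
  let ?Y = "curve_Y f u v"
  let ?P = "cf_P f d"
  let ?Q = "cf_Q us vs"
  have Y: "?Y\<^sup>2 = at_inf (curve_poly f u v)" "fls_subdegree ?Y = -2" "fls_nth ?Y (-2) = 1"
    using theI'[OF curve_Y_ex1[of f u v]] unfolding curve_Y_def by blast+
  have F: "curve_poly f u v = (?P n)\<^sup>2 + ?Q n * ?Q (n - 1)" for n
  proof -
    have "curve_poly f u v = [:f\<^sup>2 - 4 * (u * v), 4 * u, 2 * f, 0, 1:]"
      by (simp add: curve_poly_def power2_eq_square)
    also have "\<dots> = [:f\<^sup>2 - 4 * (d n * (vs n * vs (n - 1) - f - d n)),
        4 * (d n * (vs n + vs (n - 1))), 2 * f, 0, 1:]"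
      by (simp only: vs_mult vs_add)
    also have "\<dots> = (?P n)\<^sup>2 + Polynomial.smult (- 4 * d n) ([:- vs n, 1:] * [:- vs (n - 1), 1:])"
      by (simp add: cf_P_def power2_eq_square algebra_simps)
    also have "\<dots> = (?P n)\<^sup>2 + ?Q n * ?Q (n - 1)"
      by (simp only: us_mult[symmetric] cf_Q_def) (simp add: algebra_simps)
    finally show ?thesis .
  qed
  have R: "[:vs n, 1:] * ?Q n = Polynomial.smult (us n / 2) (?P (n + 1) + ?P n)" for n
  proof -
    have d_Suc: "d (n + 1) = - (vs n)\<^sup>2 - f - d n"
      using d_add[of n] by (simp add: eq_diff_eq)
    show ?thesis
      unfolding cf_P_def cf_Q_def d_Suc by (simp add: power2_eq_square algebra_simps)
  qed
  have cf: "cf_Y f u v d us vs n = at_inf (poly_floor (cf_Y f u v d us vs n)) + 1 / cf_Y f u v d us vs (n + 1)"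
    for n
  proof -
    define A where "A = Polynomial.smult (2 / us n) [:vs n, 1:]"
    define q where "q = at_inf (?Q n)"
    define q' where "q' = at_inf (?Q (n + 1))"
    define p where "p = at_inf (?P n)"
    define p' where "p' = at_inf (?P (n + 1))"
    have "A * ?Q n = ?P (n + 1) + ?P n"
      unfolding A_def mult_smult_left R using us_nonzero[of n] by simp
    then have Aq: "at_inf A * q = p' + p"
      unfolding q_def p_def p'_def by (metis at_inf_mult at_inf_add)
    have nth_q: "fls_nth (at_inf (?Q m)) (-1) = us m" for m
      by (simp add: fls_nth_at_inf cf_Q_def)
    have q: "q \<noteq> 0"
      using nth_q[of n] us_nonzero[of n] by (auto simp: q_def)
    have sub_q': "fls_subdegree q' = -1"
      using nth_q[of "n + 1"] us_nonzero[of "n + 1"]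
      by (intro fls_subdegree_eqI) (auto simp: q'_def fls_nth_at_inf cf_Q_def coeff_pCons split: nat.splits)
    \<comment> \<open>On this branch \<open>Y\<close> and \<open>P_(n+1)\<close> both begin with
      \<open>X^2\<close>, so the leading terms do not cancel.\<close>
    have nth_Yp': "fls_nth (?Y + p') (-2) = 2"
      using Y(3) by (simp add: p'_def fls_nth_at_inf cf_P_def numeral_2_eq_2)
    have sub_Yp': "fls_subdegree (?Y + p') = -2"
    proof (rule fls_subdegree_eqI)
      fix k :: int
      assume "k < -2"
      then have "fls_nth ?Y k = 0" "3 \<le> nat (- k)"
        using Y(2) by auto
      then show "fls_nth (?Y + p') k = 0"
        by (auto simp: p'_def fls_nth_at_inf cf_P_def coeff_pCons split: nat.splits)
    qed (simp only: nth_Yp', simp)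
    have Yp': "?Y + p' \<noteq> 0"
      using nth_Yp' by (metis fls_zero_nth zero_neq_numeral)
    have "(?Y - p') * (?Y + p') = at_inf (curve_poly f u v) - p' * p'"
      by (simp add: Y(1)[symmetric] power2_eq_square algebra_simps)
    also have "\<dots> = q' * q"
      unfolding F[of "n + 1"] p'_def q'_def q_def
      by (simp add: at_inf_add at_inf_mult power2_eq_square)
    finally have "(?Y - p') / q = q' / (?Y + p')"
      using q Yp' by (simp add: frac_eq_eq)
    moreover have "cf_Y f u v d us vs n = at_inf A + (?Y - p') / q"
    proof -
      have "at_inf A = (p' + p) / q"
        using q by (simp add: Aq[symmetric])
      then show ?thesis
        by (simp add: cf_Y_def p_def q_def add_divide_distrib diff_divide_distrib)
    qed
    ultimately have y: "cf_Y f u v d us vs n = at_inf A + q' / (?Y + p')"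
      by simp
    have "q' \<noteq> 0"
      using sub_q' by auto
    then have "fls_subdegree (q' / (?Y + p')) = 1"
      using Yp' by (simp add: fls_divide_subdegree sub_q' sub_Yp')
    then have "poly_floor (cf_Y f u v d us vs n) = A"
      unfolding y by (intro poly_floor_at_inf_add) simp
    moreover have "1 / cf_Y f u v d us vs (n + 1) = q' / (?Y + p')"
      by (simp add: cf_Y_def q'_def p'_def)
    ultimately show ?thesis
      using y by simp
  qed
  have "?Q 0 dvd curve_poly f u v - (?P 0)\<^sup>2"
    unfolding F[of 0] by simp
  then show ?thesis
    unfolding genus_one_data_def using u us_nonzero d_nonzero cf F R by blast
qed

section \<open>Data of a Somos-4 sequence\<close>

text \<open>Starting from \<open>h 0 = 1\<close>, the relation is solved for the next value in
  either direction; this supplies \<open>us\<close>.\<close>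

lemma ex_two_sided_product:
  fixes g :: "int \<Rightarrow> 'a :: field"
  assumes g: "\<And>n. g n \<noteq> 0"
  shows "\<exists>h. \<forall>n. h n \<noteq> 0 \<and> h n * h (n - 1) = g n"
proof -
  define a where "a = rec_nat 1 (\<lambda>k x. g (int k + 1) / x)"
  define b where "b = rec_nat 1 (\<lambda>k x. g (- int k) / x)"
  have a: "a 0 = 1" "a (Suc k) = g (int k + 1) / a k" for k
    by (simp_all add: a_def)
  have b: "b 0 = 1" "b (Suc k) = g (- int k) / b k" for k
    by (simp_all add: b_def)
  have a_nz: "a k \<noteq> 0" and b_nz: "b k \<noteq> 0" for k
    by (induction k) (simp_all add: a b g)
  define h where "h n = (if 0 \<le> n then a (nat n) else b (nat (- n)))" for n :: int
  have h_pos: "h (int k) = a k" and h_neg: "h (- int k) = b k" for k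
    by (auto simp: h_def a b)
  have "h n * h (n - 1) = g n" for n
  proof (cases "1 \<le> n")
    case True
    define k where "k = nat (n - 1)"
    have n: "n = int (Suc k)" and n1: "n - 1 = int k"
      using True by (simp_all add: k_def)
    have "h n * h (n - 1) = a (Suc k) * a k"
      unfolding n1 h_pos unfolding n h_pos ..
    also have "\<dots> = g n"
      using a_nz[of k] by (simp add: a n add.commute)
    finally show ?thesis .
  next
    case False
    define k where "k = nat (- n)"
    have n: "n = - int k" and n1: "n - 1 = - int (Suc k)"
      using False by (simp_all add: k_def)
    have "h n * h (n - 1) = b k * b (Suc k)"
      unfolding n1 h_neg unfolding n h_neg ..
    also have "\<dots> = g n"
      using b_nz[of k] by (simp add: b n)
    finally show ?thesis .
  qed
  moreover have "h n \<noteq> 0" for n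
    by (simp add: h_def a_nz b_nz)
  ultimately show ?thesis
    by blast
qed

lemma const_if_eq_pred:
  fixes g :: "int \<Rightarrow> 'a"
  assumes "\<And>n. g n = g (n - 1)"
  shows "g n = g 0"
proof (induction n rule: int_induct[where k = 0])
  case (step1 i)
  then show ?case using assms[of "i + 1"] by simp
next
  case (step2 i)
  then show ?case using assms[of i] by simp
qed simp

text \<open>The quotient of two solutions satisfies
  \<open>q (n + 2) * q n = (q (n + 1))\<^sup>2\<close>, so it is geometric.\<close>

lemma toda_unique:
  fixes g h e :: "nat \<Rightarrow> 'a :: field"
  assumes nz: "\<And>n. g n \<noteq> 0" "\<And>n. h n \<noteq> 0" and h0: "h 0 = 1"
    and g: "\<And>n. g (n + 2) * g n = e n * (g (n + 1))\<^sup>2"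
    and h: "\<And>n. h (n + 2) * h n = e n * (h (n + 1))\<^sup>2"
  shows "\<exists>b. b \<noteq> 0 \<and> (\<forall>n. g n = g 0 * b ^ n * h n)"
proof -
  define q where "q n = g n / h n" for n
  have q_nz: "q n \<noteq> 0" for n
    by (simp add: q_def nz)
  have e: "e n \<noteq> 0" for n
    using g[of n] nz(1)[of n] nz(1)[of "n + 2"] by auto
  have "q (n + 2) * q n = (q (n + 1))\<^sup>2" for n
    unfolding q_def times_divide_times_eq g h power_divide using e[of n] by simp
  then have "q (Suc (Suc n)) / q (Suc n) = q (Suc n) / q n" for n
    using q_nz by (simp add: frac_eq_eq power2_eq_square)
  then have ratio: "q (Suc n) / q n = q 1 / q 0" for n
    by (induction n) simp_all
  define b where "b = q 1 / q 0"
  have q_pow: "q n = q 0 * b ^ n" for n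
  proof (induction n)
    case (Suc n)
    have "q (Suc n) = b * q n"
      using ratio[of n] q_nz[of n] by (simp add: b_def field_simps)
    then show ?case by (simp add: Suc.IH)
  qed simp
  have "g n = g 0 * b ^ n * h n" for n
  proof -
    have "g n = q n * h n"
      by (simp add: q_def nz)
    also have "q n = q 0 * b ^ n"
      by (rule q_pow)
    also have "q 0 = g 0"
      by (simp add: q_def h0)
    finally show ?thesis .
  qed
  moreover have "b \<noteq> 0"
    by (simp add: b_def q_nz)
  ultimately show ?thesis by blast
qed

lemma somos_data_if_d_step:
  fixes d :: "int \<Rightarrow> complex"
  assumes u: "u \<noteq> 0" and d: "\<And>n. d n \<noteq> 0"
    and step: "\<And>n. d (n - 1) * (d n)\<^sup>2 * d (n + 1) = u\<^sup>2 * d n + \<beta>"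
  shows "\<exists>f v us vs. somos_data f u v d us vs"
proof -
  \<comment> \<open>\<open>vs_add\<close> prescribes \<open>v_n + v_(n-1)\<close>, and the
    difference of two instances of \<open>d_add\<close> prescribes \<open>v_n^2 - v_(n-1)^2\<close>,
    hence \<open>v_n - v_(n-1)\<close>; this is half the sum of both.\<close>
  define vs where "vs n = (u / d n + d n * (d (n - 1) - d (n + 1)) / u) / 2" for n
  \<comment> \<open>Consistency: \<open>v_(n-1)\<close> from its own definition must be half the
    difference at \<open>n\<close>. This uses \<open>step\<close> at \<open>n - 1\<close> and at
    \<open>n\<close>.\<close>
  have vs_pred: "vs (n - 1) = (u / d n - d n * (d (n - 1) - d (n + 1)) / u) / 2" for n
  proof -
    have 1: "d (n - 2) * (d (n - 1))\<^sup>2 * d n = u\<^sup>2 * d (n - 1) + \<beta>"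
      using step[of "n - 1"] by simp
    have "u * d (n - 1) * d n * (u / d (n - 1) + d (n - 1) * (d (n - 2) - d n) / u)
        = u\<^sup>2 * d n + d (n - 2) * (d (n - 1))\<^sup>2 * d n - (d (n - 1) * d n)\<^sup>2"
      using u d[of "n - 1"] by (simp add: field_simps power2_eq_square)
    also have "\<dots> = u\<^sup>2 * d (n - 1) + d (n - 1) * (d n)\<^sup>2 * d (n + 1) - (d (n - 1) * d n)\<^sup>2"
      unfolding 1 step by simp
    also have "\<dots> = u * d (n - 1) * d n * (u / d n - d n * (d (n - 1) - d (n + 1)) / u)"
      using u d[of n] by (simp add: field_simps power2_eq_square)
    finally have "u / d (n - 1) + d (n - 1) * (d (n - 2) - d n) / u
        = u / d n - d n * (d (n - 1) - d (n + 1)) / u"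
      using u d by (simp only: mult_cancel_left mult_eq_0_iff) simp
    then show ?thesis
      by (simp add: vs_def)
  qed
  have vs_sum: "vs n + vs (n - 1) = u / d n" for n
    unfolding vs_pred by (simp add: vs_def field_simps)
  have vs_diff: "vs n - vs (n - 1) = d n * (d (n - 1) - d (n + 1)) / u" for n
  proof -
    have "(a + b) / 2 - (a - b) / 2 = b" for a b :: complex
      by (simp add: field_simps)
    then show ?thesis
      unfolding vs_pred unfolding vs_def[of n] .
  qed
  have vs_add: "d n * (vs n + vs (n - 1)) = u" for n
    unfolding vs_sum using d[of n] by simp
  \<comment> \<open>The value that \<open>d_add\<close> forces on \<open>f\<close>; it must not
    depend on \<open>n\<close>.\<close>
  define F where "F n = - (vs n)\<^sup>2 - d n - d (n + 1)" for n
  have sq_diff: "(vs n)\<^sup>2 - (vs (n - 1))\<^sup>2 = d (n - 1) - d (n + 1)" for n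
  proof -
    have "(vs n)\<^sup>2 - (vs (n - 1))\<^sup>2 = (vs n + vs (n - 1)) * (vs n - vs (n - 1))"
      by (simp add: power2_eq_square algebra_simps)
    then show ?thesis
      unfolding vs_sum vs_diff using u d[of n] by simp
  qed
  have "F n - F (n - 1) = d (n - 1) - d (n + 1) - ((vs n)\<^sup>2 - (vs (n - 1))\<^sup>2)" for n
    by (simp add: F_def)
  then have "F n = F (n - 1)" for n
    unfolding sq_diff by simp
  then have F: "F n = F 0" for n
    by (rule const_if_eq_pred)
  \<comment> \<open>Likewise the value that \<open>vs_mult\<close> forces on \<open>u * v\<close>;
    the two forms below coincide after a shift of \<open>n\<close>, so it is constant.\<close>
  define V where "V n = d n * (vs n * vs (n - 1) - F 0 - d n)" for n
  have V1: "V n = u * vs n + d n * d (n + 1)" for n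
    unfolding V_def F[of n, symmetric] vs_add[of n, symmetric]
    by (simp add: F_def power2_eq_square algebra_simps)
  have "V n = u * vs (n - 1) + d n * d (n - 1)" for n
    unfolding V_def F[of "n - 1", symmetric] vs_add[of n, symmetric]
    by (simp add: F_def power2_eq_square algebra_simps)
  then have "V n = V (n - 1)" for n
    using V1[of "n - 1"] by (simp add: mult.commute)
  then have V: "V n = V 0" for n
    by (rule const_if_eq_pred)
  obtain us where us: "\<And>n. us n \<noteq> 0" "\<And>n. us n * us (n - 1) = - 4 * d n"
    using ex_two_sided_product[of "\<lambda>n. - 4 * d n"] d by auto
  have "somos_data (F 0) u (V 0 / u) d us vs"
  proof
    fix n
    show "d (n + 1) + d n = - (vs n)\<^sup>2 - F 0"
      unfolding F[of n, symmetric] by (simp add: F_def)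
    show "d n * (vs n * vs (n - 1) - F 0 - d n) = u * (V 0 / u)"
      using V[of n] u by (simp add: V_def)
  qed (fact us d vs_add)+
  then show ?thesis by blast
qed

theorem theorem5p2:
  shows "(\<forall>(f::complex) u v (d :: int \<Rightarrow> complex) us vs. genus_one_data f u v d us vs \<longrightarrow>
            (\<forall>n::nat. let \<Delta> = hankel_det (moment f d us vs); \<alpha> = u\<^sup>2; \<beta> = u\<^sup>2 * (v\<^sup>2 + f) in
               \<Delta> (n + 4) * \<Delta> n = \<alpha> * \<Delta> (n + 3) * \<Delta> (n + 1) + \<beta> * (\<Delta> (n + 2))\<^sup>2))
       \<and>
         (\<forall>(\<alpha>::complex) \<beta> (\<tau> :: int \<Rightarrow> complex).
            \<alpha> \<noteq> 0 \<longrightarrow> (\<forall>n. \<tau> n \<noteq> 0) \<longrightarrow>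
            (\<forall>n. \<tau> (n + 4) * \<tau> n = \<alpha> * \<tau> (n + 3) * \<tau> (n + 1) + \<beta> * (\<tau> (n + 2))\<^sup>2) \<longrightarrow>
            (\<exists>f u v d us vs a b a' b'.
               genus_one_data f u v d us vs \<and> \<alpha> = u\<^sup>2 \<and> \<beta> = u\<^sup>2 * (v\<^sup>2 + f) \<and>
               b \<noteq> 0 \<and> b' \<noteq> 0 \<and>
               (\<forall>n\<ge>0. \<tau> n = a * b powi n * hankel_det (moment f d us vs) (nat n)) \<and>
               (\<forall>n\<le>-1. \<tau> n = a' * b' powi n
                           * hankel_det (moment_dagger f d us vs) (nat (- n - 1)))))"
proof (intro conjI allI impI)
  fix f u v d us vs and n :: nat
  assume "genus_one_data f u v d us vs"
  then have "somos_data f u v d us vs"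
    by (rule somos_data_if_genus_one_data)
  then show "let \<Delta> = hankel_det (moment f d us vs); \<alpha> = u\<^sup>2; \<beta> = u\<^sup>2 * (v\<^sup>2 + f) in
      \<Delta> (n + 4) * \<Delta> n = \<alpha> * \<Delta> (n + 3) * \<Delta> (n + 1) + \<beta> * (\<Delta> (n + 2))\<^sup>2"
    unfolding Let_def by (rule somos_data.hankel_moment_somos)
next
  fix \<alpha> \<beta> :: complex and \<tau> :: "int \<Rightarrow> complex"
  assume \<alpha>: "\<alpha> \<noteq> 0" and "\<forall>n. \<tau> n \<noteq> 0"
    and "\<forall>n. \<tau> (n + 4) * \<tau> n = \<alpha> * \<tau> (n + 3) * \<tau> (n + 1) + \<beta> * (\<tau> (n + 2))\<^sup>2"
  then have \<tau>: "\<tau> n \<noteq> 0"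
    and somos: "\<tau> (n + 4) * \<tau> n = \<alpha> * \<tau> (n + 3) * \<tau> (n + 1) + \<beta> * (\<tau> (n + 2))\<^sup>2" for n
    by blast+
  define u where "u = csqrt \<alpha>"
  have u: "u\<^sup>2 = \<alpha>" "u \<noteq> 0"
    using \<alpha> by (simp_all add: u_def)
  \<comment> \<open>Read off from the Toda relation that the determinants satisfy.\<close>
  define d where "d n = \<tau> n * \<tau> (n - 2) / (\<tau> (n - 1))\<^sup>2" for n
  have d: "d n \<noteq> 0" for n
    by (simp add: d_def \<tau>)
  have step: "d (n - 1) * (d n)\<^sup>2 * d (n + 1) = u\<^sup>2 * d n + \<beta>" for n
  proof -
    have cancel: "(x2 * x0 / x1\<^sup>2) * (x3 * x1 / x2\<^sup>2)\<^sup>2 * (x4 * x2 / x3\<^sup>2) = x4 * x0 / x2\<^sup>2"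
      if "x1 \<noteq> 0" "x2 \<noteq> 0" "x3 \<noteq> 0" for x0 x1 x2 x3 x4 :: complex
      using that by (simp add: field_simps power2_eq_square)
    have "d (n - 1) * (d n)\<^sup>2 * d (n + 1) = \<tau> (n + 1) * \<tau> (n - 3) / (\<tau> (n - 1))\<^sup>2"
      using cancel[of "\<tau> (n - 2)" "\<tau> (n - 1)" "\<tau> n" "\<tau> (n - 3)" "\<tau> (n + 1)"] \<tau>
      by (simp add: d_def)
    also have "\<tau> (n + 1) * \<tau> (n - 3) = \<alpha> * \<tau> n * \<tau> (n - 2) + \<beta> * (\<tau> (n - 1))\<^sup>2"
      using somos[of "n - 3"] by (simp add: add.commute)
    finally show ?thesis
      using \<tau>[of "n - 1"] by (simp add: d_def u add_divide_distrib)
  qed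
  obtain f v us vs where data: "somos_data f u v d us vs"
    using somos_data_if_d_step[OF u(2) d step] by blast
  note rev = somos_data.reversed[OF data]
  have dagger: "moment_dagger f d us vs = moment f (\<lambda>k. d (1 - k)) (\<lambda>k. - us (- k)) (\<lambda>k. vs (- k))"
    by (simp add: moment_dagger_def moment_def)
  let ?H = "hankel_det (moment f d us vs)"
  let ?H' = "hankel_det (moment_dagger f d us vs)"
  \<comment> \<open>Both expressions evaluate the same product of \<open>d\<close> at index
    \<open>0\<close>.\<close>
  have "\<beta> = u\<^sup>2 * (v\<^sup>2 + f)"
    using step[of 0] somos_data.d_step[OF data, of 0] by (simp add: distrib_left)
  moreover obtain b where "b \<noteq> 0" and b: "\<And>n. \<tau> (int n) = \<tau> 0 * b ^ n * ?H n"
  proof -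
    have "\<tau> (int (n + 2)) * \<tau> (int n) = d (1 + int n + 1) * (\<tau> (int (n + 1)))\<^sup>2" for n
      using \<tau>[of "int n + 1"] by (simp add: d_def add.commute)
    then show thesis
      using toda_unique[where g = "\<lambda>n. \<tau> (int n)" and h = ?H, OF \<tau> somos_data.hankel_moment_nonzero[OF data]
          hankel_det_0 _ somos_data.hankel_moment_toda[OF data]] that by auto
  qed
  moreover obtain c where "c \<noteq> 0"
    and c: "\<And>n. \<tau> (- int n - 1) = \<tau> (- 1) * c ^ n * ?H' n"
  proof -
    \<comment> \<open>The Toda relation is symmetric under reversal, so \<open>\<tau>\<close> read
      downwards from \<open>- 1\<close> has the reversed \<open>d\<close> as its ratios.\<close>
    have "\<tau> (- int (n + 2) - 1) * \<tau> (- int n - 1)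
        = d (1 - (1 + int n + 1)) * (\<tau> (- int (n + 1) - 1))\<^sup>2" for n
    proof -
      define k where "k = - int n - 1"
      have k: "- int n - 1 = k" "- int (n + 1) - 1 = k - 1" "- int (n + 2) - 1 = k - 2"
        "1 - (1 + int n + 1) = k"
        by (simp_all add: k_def)
      show ?thesis
        unfolding k using \<tau>[of "k - 1"] by (simp add: d_def)
    qed
    then show thesis
      using toda_unique[where g = "\<lambda>n. \<tau> (- int n - 1)" and h = ?H', unfolded dagger,
          OF \<tau> somos_data.hankel_moment_nonzero[OF rev] hankel_det_0 _ somos_data.hankel_moment_toda[OF rev]]
        that unfolding dagger by auto
  qed
  moreover have "\<tau> n = \<tau> 0 * b powi n * hankel_det (moment f d us vs) (nat n)" if "n \<ge> 0" for n
    using b[of "nat n"] that by (simp add: power_int_def)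
  \<comment> \<open>For \<open>n = - m - 1\<close> the power of \<open>inverse c\<close> is
    \<open>c ^ Suc m\<close>, one factor more than \<open>c ^ m\<close>; the constant compensates by
    dividing by \<open>c\<close>.\<close>
  moreover have "\<tau> n = (\<tau> (- 1) / c) * inverse c powi n
      * hankel_det (moment_dagger f d us vs) (nat (- n - 1))" if "n \<le> - 1" for n
  proof -
    define m where "m = nat (- n - 1)"
    have n: "n = - int m - 1" and n': "n = - int (Suc m)"
      using that by (simp_all add: m_def)
    have "inverse c powi n = c ^ Suc m"
      unfolding n' power_int_minus power_int_of_nat by (simp flip: power_inverse)
    then show ?thesis
      using c[of m] \<open>c \<noteq> 0\<close> by (simp add: m_def[symmetric]) (simp add: n)
  qed
  ultimately show "\<exists>f u v d us vs a b a' b'.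
      genus_one_data f u v d us vs \<and> \<alpha> = u\<^sup>2 \<and> \<beta> = u\<^sup>2 * (v\<^sup>2 + f) \<and> b \<noteq> 0 \<and> b' \<noteq> 0 \<and>
      (\<forall>n\<ge>0. \<tau> n = a * b powi n * hankel_det (moment f d us vs) (nat n)) \<and>
      (\<forall>n\<le>-1. \<tau> n = a' * b' powi n * hankel_det (moment_dagger f d us vs) (nat (- n - 1)))"
    using somos_data.genus_one_data_if_nonzero[OF data u(2)] u(1) nonzero_imp_inverse_nonzero
    by metis
qed

end
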